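(* Assume the subcharacteristic condition $\lambda>\max_{u\in K}\rho(\nabla_ug(u))$ and the CFL condition $\frac{\lambda\Delta t}{\Delta x}\le\frac12$. If $(u_j^n,v_j^n)\in D_K^\lambda$ for all $j\in\mathbb Z$, then $u_j^{n+1}\in K$ for all $j\in\mathbb Z$, where $$u_j^{n+1}=u_j^n-\frac{\Delta t}{\Delta x}\Big(-\frac\lambda2(u_{j+1}^n-2u_j^n+u_{j-1}^n)+\frac12\big((v_{j+1}^n-g(u_{j+1}^n))e^{-\Delta t/\varepsilon}+g(u_{j+1}^n)-(v_{j-1}^n-g(u_{j-1}^n))e^{-\Delta t/\varepsilon}-g(u_{j-1}^n)\big)\Big)$$ is the $u$-update of the approximate-Riemann-solver scheme for the Jin–Xin model.
   Context: Jin–Xin model: $\partial_tu+\partial_xv=0$, $\partial_tv+\lambda^2\partial_xu=\frac1\varepsilon(g(u)-v)$, with $\varepsilon>0$, $\lambda>0$, a relaxation of the system of conservation laws $\partial_tu+\partial_xg(u)=0$, where $g$ is of class $C^2$ on a convex set $K$ of admissible states (in some $\mathbb R^m$). $\rho(\nabla_ug(u))$ is the spectral radius of the Jacobian of $g$. Set $h_\pm(u)=u\pm\frac1\lambda g(u)$ and $K_\pm=h_\pm(K)$. The following properties, recalled from the literature (Serre), are taken as given in this setting under the subcharacteristic condition: $K_+$ and $K_-$ are convex, and $K=\frac12(K_++K_-)=\{\frac12(a+b):a\in K_+,\,b\in K_-\}$. Define $$D_K^\lambda=\{(u,v):\ u+\tfrac1\lambda v\in K_+\ \text{and}\ u-\tfrac1\lambda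 v\in K_-\}.$$ $\Delta t,\Delta x>0$ are the time and space steps and $(u_j^n,v_j^n)_{j\in\mathbb Z}$ are the discrete values at time $t^n$. *)

theory Defs
  imports "HOL-Analysis.Analysis" "Jordan_Normal_Form.Spectral_Radius"
begin

no_notation Matrix.vec_index (infixl "$" 100)
hide_const (open) Matrix.mat

text \<open>
  The spectral radius of a type-indexed real matrix is the library notion for complex
  matrices, taken along an enumeration of the index type. The choice of the enumeration
  only conjugates the matrix by a permutation, so it does not affect the spectrum.
\<close>

definition complex_mat_of :: "real^'m^'m \<Rightarrow> complex mat" where
  "complex_mat_of A = Matrix.mat CARD('m) CARD('m)
     (\<lambda>(i, j). complex_of_real
        (A $ from_nat_into (UNIV :: 'm set) i $ from_nat_into (UNIV :: 'm set) j))"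

definition real_spectral_radius :: "real^'m^'m \<Rightarrow> real" where
  "real_spectral_radius A = spectral_radius (complex_mat_of A)"

text \<open>
  \<open>K\<close> need not be open, so derivatives are taken within \<open>K\<close>. This covers functions that are
  \<open>C\<^sup>2\<close> on an open neighbourhood of \<open>K\<close>. The Jacobian is an explicit argument because
  derivatives within a set with empty interior need not be unique.
\<close>

definition C2_on_with_jacobian ::
  "(real^'m \<Rightarrow> real^'m) \<Rightarrow> (real^'m \<Rightarrow> real^'m^'m) \<Rightarrow> (real^'m) set \<Rightarrow> bool" where
  "C2_on_with_jacobian g Dg K \<longleftrightarrow>
     (\<forall>u\<in>K. (g has_derivative (\<lambda>h. Dg u *v h)) (at u within K)) \<and>
     (\<exists>D2g :: real^'m \<Rightarrow> ((real^'m) \<Rightarrow>\<^sub>L (real^'m^'m)).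
        (\<forall>u\<in>K. (Dg has_derivative blinfun_apply (D2g u)) (at u within K)) \<and>
        continuous_on K D2g)"

text \<open>
  Stated pointwise: this is \<open>lam > max\<close> over \<open>K\<close> of the spectral radius whenever that maximum
  exists, and it does not require the maximum to be attained.
\<close>

definition subcharacteristic ::
  "real \<Rightarrow> (real^'m \<Rightarrow> real^'m^'m) \<Rightarrow> (real^'m) set \<Rightarrow> bool" where
  "subcharacteristic lam Dg K \<longleftrightarrow> (\<forall>u\<in>K. real_spectral_radius (Dg u) < lam)"

definition h_plus :: "real \<Rightarrow> (real^'m \<Rightarrow> real^'m) \<Rightarrow> real^'m \<Rightarrow> real^'m" where
  "h_plus lam g u = u + (1 / lam) *\<^sub>R g u"

definition h_minus :: "real \<Rightarrow> (real^'m \<Rightarrow> real^'m) \<Rightarrow> real^'m \<Rightarrow> real^'m" where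
  "h_minus lam g u = u - (1 / lam) *\<^sub>R g u"

definition K_plus :: "real \<Rightarrow> (real^'m \<Rightarrow> real^'m) \<Rightarrow> (real^'m) set \<Rightarrow> (real^'m) set" where
  "K_plus lam g K = h_plus lam g ` K"

definition K_minus :: "real \<Rightarrow> (real^'m \<Rightarrow> real^'m) \<Rightarrow> (real^'m) set \<Rightarrow> (real^'m) set" where
  "K_minus lam g K = h_minus lam g ` K"

definition D_set ::
  "real \<Rightarrow> (real^'m \<Rightarrow> real^'m) \<Rightarrow> (real^'m) set \<Rightarrow> ((real^'m) \<times> (real^'m)) set" where
  "D_set lam g K = {(u, v). u + (1 / lam) *\<^sub>R v \<in> K_plus lam g K \<and>
                            u - (1 / lam) *\<^sub>R v \<in> K_minus lam g K}"

definition jin_xin_u_update ::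
  "(real^'m \<Rightarrow> real^'m) \<Rightarrow> real \<Rightarrow> real \<Rightarrow> real \<Rightarrow> real \<Rightarrow>
   (int \<Rightarrow> real^'m) \<Rightarrow> (int \<Rightarrow> real^'m) \<Rightarrow> int \<Rightarrow> real^'m" where
  "jin_xin_u_update g lam eps dt dx u v j =
     u j - (dt / dx) *\<^sub>R
       (- (lam / 2) *\<^sub>R (u (j + 1) - 2 *\<^sub>R u j + u (j - 1))
        + (1 / 2) *\<^sub>R (exp (- dt / eps) *\<^sub>R (v (j + 1) - g (u (j + 1))) + g (u (j + 1))
                   - exp (- dt / eps) *\<^sub>R (v (j - 1) - g (u (j - 1))) - g (u (j - 1))))"

end

theory Submission
  imports Defs
begin

text \<open>
  Relaxing \<open>v\<close> towards \<open>g u\<close> by the factor \<open>s = exp (- dt / eps)\<close> gives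
  \<open>w = s v + (1 - s) g u\<close>, and the update is the upwind step for the characteristic variables
  \<open>u + w / lam\<close>, which moves right, and \<open>u - w / lam\<close>, which moves left. With \<open>c = lam dt / dx\<close>,
  it equals (lemma \<open>jin_xin_u_update_upwind\<close>)
  \<open>(1 - c) u\<^sub>j + c / 2 ((u + w / lam)\<^sub>j\<^sub>-\<^sub>1 + (u - w / lam)\<^sub>j\<^sub>+\<^sub>1)\<close>.

  Since \<open>K\<close> is the set of midpoints between \<open>K_plus\<close> and \<open>K_minus\<close>, a state \<open>(u, v)\<close> of \<open>D_set\<close>
  has \<open>u \<in> K\<close> (\<open>D_set_fst_in_K\<close>). Hence the equilibrium state \<open>(u, g u)\<close> also lies in \<open>D_set\<close>, and convexity of
  \<open>K_plus\<close> and \<open>K_minus\<close> keeps \<open>(u, w)\<close> in \<open>D_set\<close>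
  (\<open>convex_snd_slice_D_set\<close>). The midpoint property then puts the half-sum
  of the two neighbouring characteristic variables into \<open>K\<close>, and the CFL condition makes the whole
  expression a convex combination of two points of \<open>K\<close>.
\<close>

text \<open>
  For fixed \<open>u\<close>, both characteristic variables are affine in \<open>v\<close>, so the convexity of \<open>K_plus\<close>
  and \<open>K_minus\<close> carries over to the admissible values of \<open>v\<close>. It is used with \<open>w = g u\<close>, where
  \<open>s\<close> is the relaxation factor.
\<close>

lemma convex_snd_slice_D_set:
  assumes "convex (K_plus lam g K)" "convex (K_minus lam g K)"
    and "(u, v) \<in> D_set lam g K" "(u, w) \<in> D_set lam g K" "0 \<le> s" "s \<le> 1"
  shows "(u, s *\<^sub>R v + (1 - s) *\<^sub>R w) \<in> D_set lam g K"
proof -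
  have plus: "u + (1 / lam) *\<^sub>R (s *\<^sub>R v + (1 - s) *\<^sub>R w)
      = s *\<^sub>R (u + (1 / lam) *\<^sub>R v) + (1 - s) *\<^sub>R (u + (1 / lam) *\<^sub>R w)"
    by (simp add: algebra_simps diff_divide_distrib)
  have minus: "u - (1 / lam) *\<^sub>R (s *\<^sub>R v + (1 - s) *\<^sub>R w)
      = s *\<^sub>R (u - (1 / lam) *\<^sub>R v) + (1 - s) *\<^sub>R (u - (1 / lam) *\<^sub>R w)"
    by (simp add: algebra_simps diff_divide_distrib)
  show ?thesis
    using assms unfolding D_set_def
    by (simp only: mem_Collect_eq case_prod_conv plus minus) (auto intro!: convexD)
qed

lemma equilibrium_in_D_set: "u \<in> K \<Longrightarrow> (u, g u) \<in> D_set lam g K"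
  unfolding D_set_def K_plus_def K_minus_def h_plus_def h_minus_def by auto

text \<open>
  The state \<open>u\<close> is the midpoint of its own characteristic variables \<open>u + v / lam\<close> and
  \<open>u - v / lam\<close>.
\<close>

lemma D_set_fst_in_K:
  assumes mid: "K = {(1 / 2) *\<^sub>R (a + b) | a b. a \<in> K_plus lam g K \<and> b \<in> K_minus lam g K}"
    and "(u, v) \<in> D_set lam g K"
  shows "u \<in> K"
proof -
  have "u = (1 / 2) *\<^sub>R ((u + (1 / lam) *\<^sub>R v) + (u - (1 / lam) *\<^sub>R v))"
    by (simp add: scaleR_2[symmetric])
  then show ?thesis
    using assms(2) unfolding D_set_def by (subst mid) blast
qed

text \<open>
  The numerical diffusion \<open>lam / 2\<close> is exactly what turns the centred flux difference into
  upwinding: the terms \<open>u - w / lam\<close> at \<open>j - 1\<close> and \<open>u + w / lam\<close> at \<open>j + 1\<close> cancel.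
\<close>

lemma jin_xin_u_update_upwind:
  assumes "lam \<noteq> 0"
    and w: "\<And>i. w i = exp (- dt / eps) *\<^sub>R v i + (1 - exp (- dt / eps)) *\<^sub>R g (u i)"
  shows "jin_xin_u_update g lam eps dt dx u v j
    = (1 - lam * dt / dx) *\<^sub>R u j
      + (lam * dt / dx) *\<^sub>R ((1 / 2) *\<^sub>R
          ((u (j - 1) + (1 / lam) *\<^sub>R w (j - 1)) + (u (j + 1) - (1 / lam) *\<^sub>R w (j + 1))))"
  unfolding jin_xin_u_update_def w using assms(1)
  by (simp add: vec_eq_iff field_simps)

theorem proposition4:
  fixes g :: "real^'m \<Rightarrow> real^'m" and Dg :: "real^'m \<Rightarrow> real^'m^'m"
    and K :: "(real^'m) set"
    and lam eps dt dx :: real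
    and u v :: "nat \<Rightarrow> int \<Rightarrow> real^'m" and n :: nat
  assumes "lam > 0" and "eps > 0" and "dt > 0" and "dx > 0"
    and "convex K"
    and "C2_on_with_jacobian g Dg K"
    and "subcharacteristic lam Dg K"
    and "convex (K_plus lam g K)" and "convex (K_minus lam g K)"
    and "K = {(1 / 2) *\<^sub>R (a + b) | a b. a \<in> K_plus lam g K \<and> b \<in> K_minus lam g K}"
    and "lam * dt / dx \<le> 1 / 2"
    and "\<forall>j. (u n j, v n j) \<in> D_set lam g K"
    and "\<forall>j. u (Suc n) j = jin_xin_u_update g lam eps dt dx (u n) (v n) j"
  shows "\<forall>j. u (Suc n) j \<in> K"
proof
  fix j
  define w where "w i = exp (- dt / eps) *\<^sub>R v n i + (1 - exp (- dt / eps)) *\<^sub>R g (u n i)" for i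
  define c where "c = lam * dt / dx"
  have uK: "u n i \<in> K" for i
    using D_set_fst_in_K[OF assms(10)] assms(12) by blast
  have "exp (- dt / eps) \<le> 1"
    using assms(2,3) by simp
  then have w: "(u n i, w i) \<in> D_set lam g K" for i
    unfolding w_def using assms(8,9,12) uK
    by (intro convex_snd_slice_D_set equilibrium_in_D_set) auto
  have flux: "(1 / 2) *\<^sub>R ((u n (j - 1) + (1 / lam) *\<^sub>R w (j - 1))
      + (u n (j + 1) - (1 / lam) *\<^sub>R w (j + 1))) \<in> K"
    using w[of "j - 1"] w[of "j + 1"] by (subst assms(10)) (auto simp: D_set_def)
  have "0 \<le> c" "c \<le> 1"
    using assms(1,3,4,11) by (simp_all add: c_def)
  then show "u (Suc n) j \<in> K"
    using convexD[OF assms(5) uK[of j] flux, of "1 - c" c] assms(1,13)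
      jin_xin_u_update_upwind[of lam w dt eps "v n" g "u n" dx j]
    by (simp add: w_def c_def)
qed

end
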